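(* Assume that $f_0=\sum_{i=1}^mf_0^i$ with each $f_0^i:\mathbb R^n\to\mathbb R$ convex, and that there are constants $C_1,\dots,C_m$ such that $\|v\|\le C_i$ for all $x\in\mathbb R^n$, all $v\in\partial f_0^i(x)$ and all $i\in\{1,\dots,m\}$. Assume that $f_1$ has a bounded subgradient (there is $C$ with $\|v\|\le C$ for all $x\in\mathbb R^n$ and $v\in\partial f_1(x)$). Let $\{\lambda_k\}$ and $\{\mu_k\}$ be non-negative scalar sequences converging to $0$ such that $\sum_{k=0}^\infty\lambda_k=\infty$, $\sum_{k=0}^\infty\mu_k=\infty$, $\mu_k/\lambda_k\to0$ and $\lambda_k^2/\mu_k\to0$. Let $\{x_k\}$ be generated by the Incremental Iterative Bilevel Algorithm (described in the context), and suppose that $\{f_1(x_{k+1/3})\}$ is bounded from below, that $X_2\ne\emptyset$ and $X_2$ is bounded (or $\{x_k\}$ is bounded), and that $\mathcal O_{f_1}$ satisfies Properties 1 and 2 (given in the context) with $\rho_1(\mu_k,k)\to0$. Then $$\lim_{k\to\infty}d_{X_2}(x_k)=0.$$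
   Context: $f_0,f_1:\mathbb R^n\to\mathbb R$ are convex functions, $X_0\subset\mathbb R^n$ is a nonempty closed convex set, $\|\cdot\|$ is the Euclidean norm, $\partial f$ is the convex subdifferential. For a nonempty closed convex set $X$, $\mathcal P_X(x)=\operatorname{argmin}_{y\in X}\|x-y\|$ and $d_X(x)=\|x-\mathcal P_X(x)\|$. For $i\in\{0,1\}$, $f_i^*$ is the optimal value of $f_i$ over $X_i$ and $X_{i+1}=\{x\in X_i:f_i(x)=f_i^*\}$. The stepsizes $\lambda_k,\mu_k$ are positive so that the quotients make sense. The incremental subgradient operator $\mathcal I_{f_0}(\lambda,x)$ for $f_0=\sum_{i=1}^mf_0^i$ is defined by $x^{(1)}=x$, $x^{(i+1)}=x^{(i)}-\lambda\tilde\nabla f_0^i(x^{(i)})$ for $i=1,\dots,m$, where $\tilde\nabla f_0^i(x^{(i)})\in\partial f_0^i(x^{(i)})$ is any chosen subgradient, and $\mathcal I_{f_0}(\lambda,x)=x^{(m+1)}$. The operator $\mathcal O_{f_1}:[0,\infty)\times\mathbb R^n\to\mathbb R^n$ comes with a real-valued error term $\rho_1(\lambda,k)$, $\lambda\ge0$, $k\in\mathbb N$. Property 1 (for $\mathcal O_{f_1}$): there is $\beta>0$ such that for any $\lambda\ge0$, all $k\in\mathbb N$ and all $x,y\in\mathbb R^n$, $$\|\mathcal O_{f_1}(\lambda,x)-y\|^2\le\|x-y\|^2-\beta\lambda\bigl(f_1(\mathcal O_{f_1}(\lambda,x))-f_1(y)\bigr)+\lambda\rho_1(\lambda,k).$$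 Property 2 (for $\mathcal O_{f_1}$): there exists $\gamma>0$ such that $\|x-\mathcal O_{f_1}(\lambda,x)\|\le\lambda\gamma$ for all $\lambda\ge0$ and $x\in\mathbb R^n$. Incremental Iterative Bilevel Algorithm. Input: $x_0\in\mathbb R^n$, $\{\lambda_k\}$, $\{\mu_k\}$. For $k=0,1,2,\dots$: $x_{k+1/3}=\mathcal I_{f_0}(\lambda_k,x_k)$; $x_{k+2/3}=\mathcal O_{f_1}(\mu_k,x_{k+1/3})$; $x_{k+1}=\mathcal P_{X_0}(x_{k+2/3})$. *)

theory Defs
  imports "HOL-Analysis.Analysis"
begin

definition subdifferential :: "('a::euclidean_space \<Rightarrow> real) \<Rightarrow> 'a \<Rightarrow> 'a set" where
  "subdifferential f x = {v. \<forall>y. f y \<ge> f x + v \<bullet> (y - x)}"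

(* The optimal value is extended real, so that an objective that is unbounded below on X,
   or an empty X, yields an empty set of minimizers rather than one defined from an
   unspecified real infimum. *)
definition optimal_value :: "('a \<Rightarrow> real) \<Rightarrow> 'a set \<Rightarrow> ereal" where
  "optimal_value f X = (INF x\<in>X. ereal (f x))"

definition optimal_set :: "('a \<Rightarrow> real) \<Rightarrow> 'a set \<Rightarrow> 'a set" where
  "optimal_set f X = {x \<in> X. ereal (f x) = optimal_value f X}"

definition proj_dist :: "'a::euclidean_space set \<Rightarrow> 'a \<Rightarrow> real" where
  "proj_dist X x = norm (x - closest_point X x)"

(* All possible results of one pass over the m components, ranging over every choice of
   subgradients.  No fixed selection is imposed: the subgradient used at a point may differ
   from one pass to another. *)
definition incremental_subgradient ::
    "nat \<Rightarrow> (nat \<Rightarrow> 'a::euclidean_space \<Rightarrow> real) \<Rightarrow> real \<Rightarrow> 'a \<Rightarrow> 'a set" where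
  "incremental_subgradient m F lam x =
     {z. \<exists>w :: nat \<Rightarrow> 'a. w 1 = x \<and>
          (\<forall>i\<in>{1..m}. \<exists>v \<in> subdifferential (F i) (w i). w (i + 1) = w i - lam *\<^sub>R v) \<and>
          z = w (m + 1)}"

definition descent_property ::
    "('a::euclidean_space \<Rightarrow> real) \<Rightarrow> (real \<Rightarrow> 'a \<Rightarrow> 'a) \<Rightarrow> (real \<Rightarrow> nat \<Rightarrow> real) \<Rightarrow> bool" where
  "descent_property f Op rho \<longleftrightarrow>
     (\<exists>\<beta>>0. \<forall>lam\<ge>0. \<forall>k x y.
        (norm (Op lam x - y))\<^sup>2
          \<le> (norm (x - y))\<^sup>2 - \<beta> * lam * (f (Op lam x) - f y) + lam * rho lam k)"

definition step_bound_property :: "(real \<Rightarrow> 'a::euclidean_space \<Rightarrow> 'a) \<Rightarrow> bool" where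
  "step_bound_property Op \<longleftrightarrow> (\<exists>\<gamma>>0. \<forall>lam\<ge>0. \<forall>x. norm (x - Op lam x) \<le> lam * \<gamma>)"

(* y k and z k are the intermediate iterates with index k + 1/3 and k + 2/3. *)
definition incremental_bilevel_iterates ::
    "nat \<Rightarrow> (nat \<Rightarrow> 'a::euclidean_space \<Rightarrow> real) \<Rightarrow> (real \<Rightarrow> 'a \<Rightarrow> 'a) \<Rightarrow> 'a set \<Rightarrow>
     (nat \<Rightarrow> real) \<Rightarrow> (nat \<Rightarrow> real) \<Rightarrow> (nat \<Rightarrow> 'a) \<Rightarrow> (nat \<Rightarrow> 'a) \<Rightarrow> (nat \<Rightarrow> 'a) \<Rightarrow> bool" where
  "incremental_bilevel_iterates m F Op X0 lam mu x y z \<longleftrightarrow>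
     (\<forall>k. y k \<in> incremental_subgradient m F (lam k) (x k) \<and>
          z k = Op (mu k) (y k) \<and>
          x (Suc k) = closest_point X0 (z k))"

end

theory Submission imports Defs begin

text \<open>
  Write \<open>d\<^sub>k\<close> for the distance from \<open>x k\<close> to \<open>X2\<close>, and \<open>a\<^sub>k\<close>, \<open>b\<^sub>k\<close> for the excess of \<open>f0\<close> and
  \<open>f1\<close> at \<open>x k\<close> over their common values on \<open>X2\<close>.  One iteration satisfies
  \<open>d\<^sub>k\<^sub>+\<^sub>1\<^sup>2 \<le> d\<^sub>k\<^sup>2 - 2 \<lambda>\<^sub>k a\<^sub>k - \<beta> \<mu>\<^sub>k b\<^sub>k + \<mu>\<^sub>k e\<^sub>k\<close> with \<open>e\<^sub>k \<rightarrow> 0\<close>: the error of the incremental pass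
  is of order \<open>\<lambda>\<^sub>k\<^sup>2\<close>, which is negligible against \<open>\<mu>\<^sub>k\<close>
  (lemma \<open>incremental_subgradient_pass\<close>), and \<open>f1\<close>, being Lipschitz, changes by a vanishing amount
  between \<open>x k\<close> and \<open>z k\<close>.

  The point is that no separate convergence towards \<open>X1\<close> has to be established.  Since \<open>X2\<close> is the
  set where the convex function \<open>g = max (f0 - f0\<^sup>*) (f1 - f1\<^sup>*)\<close> is nonpositive on \<open>X0\<close>, a
  compactness argument shows that \<open>g\<close> is bounded below by some \<open>c > 0\<close> at all points of \<open>X0\<close> that
  are at distance at least \<open>\<delta>\<close> from \<open>X2\<close>, on bounded sets always and globally
  if \<open>X2\<close> is bounded (lemmas \<open>positive_gap_on_bounded\<close> and \<open>positive_gap_of_bounded_sublevel\<close>).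
  Hence if \<open>d\<^sub>k \<ge> \<delta>\<close>, then \<open>a\<^sub>k \<ge> c\<close> or \<open>b\<^sub>k \<ge> c\<close>.  If \<open>b\<^sub>k \<ge> c\<close>, then \<open>d\<^sub>k\<^sup>2\<close> drops by a multiple
  of \<open>\<mu>\<^sub>k\<close> because \<open>a\<^sub>k \<ge> 0\<close> for \<open>k \<ge> 1\<close>.  If \<open>a\<^sub>k \<ge> c\<close>, it drops as well: \<open>b\<^sub>k\<close> may be negative but is bounded
  below, and \<open>\<lambda>\<^sub>k\<close> dominates \<open>\<mu>\<^sub>k\<close>.

  So \<open>d\<^sub>k\<^sup>2\<close> decreases by a fixed multiple of \<open>\<mu>\<^sub>k\<close> whenever \<open>d\<^sub>k \<ge> \<delta>\<close>.  As \<open>\<Sum> \<mu>\<^sub>k = \<infinity>\<close>, the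
  sequence \<open>d\<^sub>k\<close> must fall below \<open>\<delta>\<close>, and as the steps vanish it can afterwards exceed \<open>\<delta>\<close> only by a
  vanishing amount (lemma \<open>tendsto_zero_of_decrease_away_from_zero\<close>).
\<close>

section \<open>Subgradients of convex functions\<close>

text \<open>
  The strict epigraph, translated so that the graph point over \<open>x\<close> is the origin, is convex and
  misses the origin.  A hyperplane separating the two cannot be vertical, because \<open>f\<close> is
  finite everywhere, so its slope is a subgradient.
\<close>

lemma subdifferential_nonempty:
  fixes f :: "'a::euclidean_space \<Rightarrow> real"
  assumes "convex_on UNIV f"
  shows "subdifferential f x \<noteq> {}"
proof -
  define S where "S = {p :: 'a \<times> real. f (x + fst p) - f x < snd p}"
  have "convex S"
    unfolding convex_def
  proof (intro ballI allI impI)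
    fix p q :: "'a \<times> real" and u v :: real
    assume p: "p \<in> S" and q: "q \<in> S" and u: "0 \<le> u" and v: "0 \<le> v" and uv: "u + v = 1"
    have "x + fst (u *\<^sub>R p + v *\<^sub>R q) = (u + v) *\<^sub>R x + (u *\<^sub>R fst p + v *\<^sub>R fst q)"
      using uv by simp
    also have "\<dots> = u *\<^sub>R (x + fst p) + v *\<^sub>R (x + fst q)"
      by (simp add: algebra_simps)
    finally have "f (x + fst (u *\<^sub>R p + v *\<^sub>R q)) \<le> u * f (x + fst p) + v * f (x + fst q)"
      using assms u v uv unfolding convex_on_def by simp
    also have "\<dots> < u * (snd p + f x) + v * (snd q + f x)"
    proof (cases "u = 0")
      case True
      then show ?thesis using uv q by (simp add: S_def)
    next
      case False
      then have "u * f (x + fst p) < u * (snd p + f x)"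
        using u p by (simp add: S_def)
      moreover have "v * f (x + fst q) \<le> v * (snd q + f x)"
        using v q by (intro mult_left_mono) (auto simp: S_def)
      ultimately show ?thesis by linarith
    qed
    also have "\<dots> = u * snd p + v * snd q + (u + v) * f x"
      by (simp add: algebra_simps)
    finally show "u *\<^sub>R p + v *\<^sub>R q \<in> S"
      using uv by (simp add: S_def)
  qed
  moreover have "0 \<notin> S" by (simp add: S_def)
  ultimately obtain n where "n \<noteq> 0" and n: "\<And>p. p \<in> S \<Longrightarrow> 0 \<le> n \<bullet> p"
    using separating_hyperplane_set_0[of S] by blast
  obtain a b where ab: "n = (a, b)" by (cases n)
  have sep: "0 \<le> a \<bullet> h + b * t" if "f (x + h) - f x < t" for h t
    using n[of "(h, t)"] that by (simp add: S_def ab)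
  have "b \<ge> 0" using sep[of 0 1] by simp
  have "b \<noteq> 0"
  proof
    assume "b = 0"
    then have "a \<bullet> (- a) \<ge> 0"
      using sep[of "- a" "f (x + - a) - f x + 1"] by simp
    then have "a = 0" by (metis inner_ge_zero inner_eq_zero_iff inner_minus_right neg_0_le_iff_le order_antisym)
    with \<open>b = 0\<close> \<open>n \<noteq> 0\<close> ab show False by (simp add: zero_prod_def)
  qed
  with \<open>b \<ge> 0\<close> have b: "b > 0" by simp
  have "f x + (- (1 / b) *\<^sub>R a) \<bullet> (y - x) \<le> f y" for y
  proof (rule field_le_epsilon)
    fix e :: real assume "e > 0"
    then have "0 \<le> a \<bullet> (y - x) + b * (f y - f x + e)"
      by (intro sep) simp
    then have "0 \<le> (a \<bullet> (y - x) + b * (f y - f x + e)) / b" using b by simp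
    also have "\<dots> = (a \<bullet> (y - x)) / b + (f y - f x + e)"
      using b by (simp add: add_divide_distrib)
    finally show "f x + (- (1 / b) *\<^sub>R a) \<bullet> (y - x) \<le> f y + e" by simp
  qed
  then show ?thesis unfolding subdifferential_def by blast
qed

lemma convex_bounded_subdifferential_lipschitz:
  fixes f :: "'a::euclidean_space \<Rightarrow> real"
  assumes "convex_on UNIV f"
    and bound: "\<And>u v. v \<in> subdifferential f u \<Longrightarrow> norm v \<le> L"
  shows "f u - f w \<le> L * norm (u - w)"
proof -
  obtain v where v: "v \<in> subdifferential f u"
    using subdifferential_nonempty[OF assms(1)] by blast
  then have "f w \<ge> f u + v \<bullet> (w - u)" by (simp add: subdifferential_def)
  then have "f u - f w \<le> v \<bullet> (u - w)" by (simp add: inner_diff_right)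
  also have "\<dots> \<le> norm v * norm (u - w)" by (rule norm_cauchy_schwarz)
  also have "\<dots> \<le> L * norm (u - w)" using bound[OF v] by (rule mult_right_mono) simp
  finally show ?thesis .
qed

lemma subdifferential_bound_nonneg:
  fixes f :: "'a::euclidean_space \<Rightarrow> real"
  assumes "convex_on UNIV f" "\<And>u v. v \<in> subdifferential f u \<Longrightarrow> norm v \<le> L"
  shows "L \<ge> 0"
  using subdifferential_nonempty[OF assms(1)] assms(2) norm_ge_zero order_trans by blast

lemma convex_on_finite_sum:
  assumes "finite A" "convex X" "\<And>i. i \<in> A \<Longrightarrow> convex_on X (F i)"
  shows "convex_on X (\<lambda>u. \<Sum>i\<in>A. F i u :: real)"
  using assms(1,3)
proof (induction A rule: finite_induct)
  case empty
  then show ?case using assms(2) by (simp add: convex_on_const)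
next
  case (insert i A)
  then have "convex_on X (\<lambda>u. F i u + (\<Sum>j\<in>A. F j u))"
    by (intro convex_on_add) auto
  then show ?case using insert by simp
qed

section \<open>One pass of the incremental subgradient method\<close>

text \<open>
  The subgradient inequality holds for \<open>F j\<close> at the intermediate point \<open>w j\<close>.  Moving it back to the
  starting point \<open>w 1\<close> costs at most \<open>C j\<close> times the distance already travelled, and these costs add
  up to the cross terms of \<open>(\<Sum>i. C i)\<^sup>2\<close>.
\<close>

lemma incremental_subgradient_steps:
  fixes F :: "nat \<Rightarrow> 'a::euclidean_space \<Rightarrow> real" and w :: "nat \<Rightarrow> 'a"
  assumes cvx: "\<And>i. i \<in> {1..m} \<Longrightarrow> convex_on UNIV (F i)"
    and bound: "\<And>i u v. i \<in> {1..m} \<Longrightarrow> v \<in> subdifferential (F i) u \<Longrightarrow> norm v \<le> C i"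
    and lam: "lam \<ge> 0"
    and step: "\<And>i. i \<in> {1..m} \<Longrightarrow> \<exists>v \<in> subdifferential (F i) (w i). w (i + 1) = w i - lam *\<^sub>R v"
  shows "j \<le> m \<Longrightarrow> norm (w (j + 1) - w 1) \<le> lam * (\<Sum>i\<in>{1..j}. C i) \<and>
    (norm (w (j + 1) - u))\<^sup>2
      \<le> (norm (w 1 - u))\<^sup>2 - 2 * lam * (\<Sum>i\<in>{1..j}. F i (w 1) - F i u) + lam\<^sup>2 * (\<Sum>i\<in>{1..j}. C i)\<^sup>2"
proof (induction j)
  case 0
  then show ?case by simp
next
  case (Suc j)
  let ?S = "\<Sum>i\<in>{1..j}. C i" and ?c = "C (Suc j)"
  have j: "Suc j \<in> {1..m}" using Suc.prems by simp
  obtain v where v: "v \<in> subdifferential (F (Suc j)) (w (Suc j))"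
    and w: "w (Suc j + 1) = w (Suc j) - lam *\<^sub>R v" using step[OF j] by blast
  have nv: "norm v \<le> ?c" by (rule bound[OF j v])
  have c: "?c \<ge> 0" using nv norm_ge_zero order_trans by blast
  have IH1: "norm (w (Suc j) - w 1) \<le> lam * ?S"
    and IH2: "(norm (w (Suc j) - u))\<^sup>2
      \<le> (norm (w 1 - u))\<^sup>2 - 2 * lam * (\<Sum>i\<in>{1..j}. F i (w 1) - F i u) + lam\<^sup>2 * ?S\<^sup>2"
    using Suc by auto
  have "norm (w (Suc j + 1) - w 1) \<le> norm (w (Suc j) - w 1) + norm (lam *\<^sub>R v)"
    unfolding w using norm_triangle_ineq4[of "w (Suc j) - w 1" "lam *\<^sub>R v"]
    by (simp add: algebra_simps)
  also have "\<dots> \<le> lam * ?S + lam * ?c"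
    using IH1 nv lam by (auto intro!: add_mono mult_left_mono)
  finally have 1: "norm (w (Suc j + 1) - w 1) \<le> lam * (\<Sum>i\<in>{1..Suc j}. C i)"
    by (simp add: algebra_simps)
  have "F (Suc j) (w 1) - F (Suc j) (w (Suc j)) \<le> ?c * norm (w 1 - w (Suc j))"
    by (rule convex_bounded_subdifferential_lipschitz[OF cvx[OF j] bound[OF j]])
  also have "\<dots> \<le> ?c * (lam * ?S)"
    using IH1 c by (intro mult_left_mono) (simp_all add: norm_minus_commute)
  finally have A: "F (Suc j) (w 1) - F (Suc j) (w (Suc j)) \<le> ?c * (lam * ?S)" .
  have "F (Suc j) (w (Suc j)) - F (Suc j) u \<le> v \<bullet> (w (Suc j) - u)"
  proof -
    have "F (Suc j) u \<ge> F (Suc j) (w (Suc j)) + v \<bullet> (u - w (Suc j))"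
      using v by (simp add: subdifferential_def)
    then show ?thesis by (simp add: inner_diff_right)
  qed
  with A have "F (Suc j) (w 1) - F (Suc j) u - ?c * (lam * ?S) \<le> v \<bullet> (w (Suc j) - u)" by linarith
  then have B: "2 * lam * (F (Suc j) (w 1) - F (Suc j) u - ?c * (lam * ?S))
      \<le> 2 * lam * (v \<bullet> (w (Suc j) - u))"
    using lam by (intro mult_left_mono) auto
  have N: "lam\<^sup>2 * (norm v)\<^sup>2 \<le> lam\<^sup>2 * ?c\<^sup>2"
    using nv by (intro mult_left_mono power_mono) auto
  have "(norm (w (Suc j + 1) - u))\<^sup>2 = (norm ((w (Suc j) - u) - lam *\<^sub>R v))\<^sup>2"
    unfolding w by (simp add: algebra_simps)
  also have "\<dots> = (norm (w (Suc j) - u))\<^sup>2 - 2 * lam * (v \<bullet> (w (Suc j) - u)) + lam\<^sup>2 * (norm v)\<^sup>2"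
    by (simp only: power2_norm_eq_inner)
       (simp add: inner_diff_left inner_diff_right inner_commute algebra_simps power2_eq_square)
  also have "\<dots> \<le> (norm (w 1 - u))\<^sup>2 - 2 * lam * (\<Sum>i\<in>{1..j}. F i (w 1) - F i u) + lam\<^sup>2 * ?S\<^sup>2
      - 2 * lam * (F (Suc j) (w 1) - F (Suc j) u - ?c * (lam * ?S)) + lam\<^sup>2 * ?c\<^sup>2"
    using IH2 B N by linarith
  also have "\<dots> = (norm (w 1 - u))\<^sup>2 - 2 * lam * (\<Sum>i\<in>{1..Suc j}. F i (w 1) - F i u)
      + lam\<^sup>2 * (\<Sum>i\<in>{1..Suc j}. C i)\<^sup>2"
    by (simp add: algebra_simps power2_eq_square)
  finally show ?case using 1 by blast
qed

lemma incremental_subgradient_pass: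
  fixes F :: "nat \<Rightarrow> 'a::euclidean_space \<Rightarrow> real"
  assumes "\<And>i. i \<in> {1..m} \<Longrightarrow> convex_on UNIV (F i)"
    and "\<And>i u v. i \<in> {1..m} \<Longrightarrow> v \<in> subdifferential (F i) u \<Longrightarrow> norm v \<le> C i"
    and "lam \<ge> 0"
    and y: "y \<in> incremental_subgradient m F lam x"
  shows "norm (y - x) \<le> lam * (\<Sum>i\<in>{1..m}. C i)"
    and "(norm (y - u))\<^sup>2
      \<le> (norm (x - u))\<^sup>2 - 2 * lam * ((\<Sum>i\<in>{1..m}. F i x) - (\<Sum>i\<in>{1..m}. F i u))
        + lam\<^sup>2 * (\<Sum>i\<in>{1..m}. C i)\<^sup>2"
proof -
  obtain w where w: "w 1 = x" "y = w (m + 1)"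
    and step: "\<And>i. i \<in> {1..m} \<Longrightarrow> \<exists>v \<in> subdifferential (F i) (w i). w (i + 1) = w i - lam *\<^sub>R v"
    using y unfolding incremental_subgradient_def by blast
  note * = incremental_subgradient_steps[where m = m and F = F and C = C and lam = lam
      and w = w and j = m and u = u, OF assms(1-3) step order_refl]
  show "norm (y - x) \<le> lam * (\<Sum>i\<in>{1..m}. C i)"
    using * w by simp
  show "(norm (y - u))\<^sup>2
      \<le> (norm (x - u))\<^sup>2 - 2 * lam * ((\<Sum>i\<in>{1..m}. F i x) - (\<Sum>i\<in>{1..m}. F i u))
        + lam\<^sup>2 * (\<Sum>i\<in>{1..m}. C i)\<^sup>2"
    using * w by (simp add: sum_subtractf)
qed

section \<open>Minimizers and distances\<close>

text \<open>
  Once a minimizer is known, the extended-real optimal value is finite and the solution set becomes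
  an ordinary sublevel set.
\<close>

lemma optimal_set_sublevel:
  assumes "u \<in> optimal_set f X"
  shows "optimal_set f X = {x \<in> X. f x \<le> f u}" and "u \<in> X" and "x \<in> X \<Longrightarrow> f u \<le> f x"
proof -
  show "u \<in> X" using assms by (simp add: optimal_set_def)
  have opt: "optimal_value f X = ereal (f u)" using assms by (simp add: optimal_set_def)
  have le: "f u \<le> f x" if "x \<in> X" for x
  proof -
    have "optimal_value f X \<le> ereal (f x)"
      unfolding optimal_value_def using that by (rule INF_lower)
    then show ?thesis by (simp add: opt)
  qed
  then show "x \<in> X \<Longrightarrow> f u \<le> f x" .
  show "optimal_set f X = {x \<in> X. f x \<le> f u}"
    using le unfolding optimal_set_def opt by (auto intro: antisym)
qed

lemma proj_dist_eq_infdist: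
  fixes X :: "'a::euclidean_space set"
  assumes "closed X" "X \<noteq> {}"
  shows "proj_dist X x = infdist x X"
proof (rule antisym)
  show "infdist x X \<le> proj_dist X x"
    using infdist_le[OF closest_point_in_set[OF assms], of x] by (simp add: proj_dist_def dist_norm)
  show "proj_dist X x \<le> infdist x X"
    unfolding infdist_notempty[OF assms(2)]
    using closest_point_le[OF assms(1)] assms(2)
    by (intro cINF_greatest) (auto simp: proj_dist_def dist_norm)
qed

section \<open>Growth away from a sublevel set\<close>

text \<open>
  The points of \<open>X \<inter> closure B\<close> at distance at least \<open>\<delta>\<close> from the sublevel set form a compact set on
  which \<open>g\<close> is positive; unless this set is empty, \<open>g\<close> attains a positive minimum there.
\<close>

lemma positive_gap_on_bounded:
  fixes g :: "'a::euclidean_space \<Rightarrow> real"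
  assumes "closed X" "continuous_on UNIV g" "bounded B" "\<delta> > 0"
  shows "\<exists>c>0. \<forall>x\<in>X \<inter> B. infdist x {u\<in>X. g u \<le> 0} \<ge> \<delta> \<longrightarrow> g x \<ge> c"
proof -
  let ?Z = "{u\<in>X. g u \<le> 0}"
  define K where "K = X \<inter> closure B \<inter> {x. \<delta> \<le> infdist x ?Z}"
  have "closed {x. \<delta> \<le> infdist x ?Z}"
    by (intro closed_Collect_le continuous_intros)
  then have "compact K"
    unfolding K_def using assms(1,3)
    by (auto simp: compact_eq_bounded_closed intro: bounded_subset[OF bounded_closure])
  have pos: "g x > 0" if "x \<in> K" for x
  proof (rule ccontr)
    assume "\<not> g x > 0"
    then have "x \<in> ?Z" using that by (simp add: K_def)
    then have "infdist x ?Z = 0" by (rule infdist_zero)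
    then show False using that assms(4) by (simp add: K_def)
  qed
  show ?thesis
  proof (cases "K = {}")
    case True
    then show ?thesis
      using closure_subset[of B] unfolding K_def by (intro exI[of _ 1]) auto
  next
    case False
    then obtain p where p: "p \<in> K" "\<And>x. x \<in> K \<Longrightarrow> g p \<le> g x"
      using continuous_attains_inf[OF \<open>compact K\<close> False continuous_on_subset[OF assms(2)]] by auto
    show ?thesis
      using p pos[OF p(1)] closure_subset[of B] unfolding K_def by (intro exI[of _ "g p"]) auto
  qed
qed

text \<open>
  With a bounded sublevel set, convexity propagates the gap to infinity: on the segment from a
  remote point \<open>x\<close> to its closest point \<open>p\<close> in the sublevel set, the point \<open>q\<close> with
  \<open>norm (q - p) = \<delta>\<close> is still at distance \<open>\<delta>\<close> from the sublevel set.  Such points \<open>q\<close> form a bounded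
  set, and \<open>g q \<le> g x\<close> because \<open>g\<close> is nonpositive at \<open>p\<close> and positive at \<open>q\<close>.
\<close>

lemma positive_gap_of_bounded_sublevel:
  fixes g :: "'a::euclidean_space \<Rightarrow> real"
  assumes "closed X" "convex X" "convex_on UNIV g" "\<delta> > 0"
    and "bounded {u\<in>X. g u \<le> 0}" "{u\<in>X. g u \<le> 0} \<noteq> {}"
  shows "\<exists>c>0. \<forall>x\<in>X. infdist x {u\<in>X. g u \<le> 0} \<ge> \<delta> \<longrightarrow> g x \<ge> c"
proof -
  define Z where "Z = {u\<in>X. g u \<le> 0}"
  have cont: "continuous_on UNIV g"
    using assms(3) by (intro convex_on_continuous) auto
  have "closed {u. g u \<le> 0}"
    using cont by (intro closed_Collect_le continuous_intros) auto
  moreover have "Z = X \<inter> {u. g u \<le> 0}" by (auto simp: Z_def)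
  ultimately have "closed Z" using assms(1) by (simp add: closed_Int)
  have "Z \<noteq> {}" "bounded Z" using assms by (auto simp: Z_def)
  then obtain R where R: "\<And>u. u \<in> Z \<Longrightarrow> norm u \<le> R" unfolding bounded_iff by blast
  obtain c where c: "c > 0" "\<And>x. x \<in> X \<Longrightarrow> x \<in> cball 0 (R + \<delta>) \<Longrightarrow> infdist x Z \<ge> \<delta> \<Longrightarrow> g x \<ge> c"
    using positive_gap_on_bounded[OF assms(1) cont bounded_cball assms(4)] unfolding Z_def by blast
  have "g x \<ge> c" if x: "x \<in> X" "infdist x Z \<ge> \<delta>" for x
  proof -
    define p where "p = closest_point Z x"
    define d where "d = infdist x Z"
    define t where "t = \<delta> / d"
    define q where "q = (1 - t) *\<^sub>R p + t *\<^sub>R x"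
    have p: "p \<in> Z" unfolding p_def by (rule closest_point_in_set) fact+
    have d: "norm (x - p) = d"
      using proj_dist_eq_infdist[OF \<open>closed Z\<close> \<open>Z \<noteq> {}\<close>] by (simp add: d_def p_def proj_dist_def)
    have "d \<ge> \<delta>" using x by (simp add: d_def)
    then have t: "0 < t" "t \<le> 1" "t * d = \<delta>" using assms(4) by (auto simp: t_def)
    have "q \<in> X"
      unfolding q_def using assms(2) p x t by (intro convexD) (auto simp: Z_def)
    have "q - p = t *\<^sub>R (x - p)" by (simp add: q_def algebra_simps)
    then have "norm (q - p) = \<delta>" using t d by simp
    then have "q \<in> cball 0 (R + \<delta>)"
      using R[OF p] norm_triangle_ineq2[of q p] by simp
    moreover have "infdist q Z \<ge> \<delta>"
    proof -
      have "x - q = (1 - t) *\<^sub>R (x - p)" by (simp add: q_def algebra_simps)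
      then have "dist x q = (1 - t) * d" using t d by (simp add: dist_norm)
      moreover have "d \<le> infdist q Z + dist x q"
        unfolding d_def by (rule infdist_triangle)
      ultimately show ?thesis using t by (simp add: algebra_simps)
    qed
    ultimately have "c \<le> g q" using c \<open>q \<in> X\<close> by blast
    also have "g q \<le> (1 - t) * g p + t * g x"
      using assms(3) t unfolding q_def convex_on_def by simp
    also have "\<dots> \<le> t * g x"
      using p t by (simp add: Z_def mult_nonneg_nonpos)
    finally have *: "c \<le> t * g x" .
    then have "g x \<ge> 0" using c(1) t by (smt (verit) mult_pos_neg)
    then have "t * g x \<le> 1 * g x" using t by (intro mult_right_mono) auto
    with * show ?thesis by simp
  qed
  then show ?thesis using c(1) unfolding Z_def by blast
qed

section \<open>Sequences that decrease away from zero\<close>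

text \<open>
  Divergence of \<open>\<Sum> \<mu>\<^sub>k\<close> forces the sequence below every \<open>\<delta>\<close> at arbitrarily late times.  From then
  on it stays below \<open>2 \<delta>\<close>: from below \<open>\<delta>\<close> one step raises it by at most \<open>\<delta>\<close>, and between \<open>\<delta>\<close> and
  \<open>2 \<delta>\<close> it decreases.
\<close>

lemma tendsto_zero_of_decrease_away_from_zero:
  fixes d s mu :: "nat \<Rightarrow> real"
  assumes d: "\<And>k. d k \<ge> 0"
    and step: "\<forall>\<^sub>F k in sequentially. d (Suc k) \<le> d k + s k"
    and s: "s \<longlonglongrightarrow> 0"
    and mu: "\<And>k. mu k \<ge> 0" and div: "filterlim (\<lambda>N. \<Sum>k<N. mu k) at_top sequentially"
    and decr: "\<And>\<delta>. \<delta> > 0 \<Longrightarrow>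
      \<exists>c>0. \<forall>\<^sub>F k in sequentially. d k \<ge> \<delta> \<longrightarrow> (d (Suc k))\<^sup>2 \<le> (d k)\<^sup>2 - c * mu k"
  shows "d \<longlonglongrightarrow> 0"
proof (rule LIMSEQ_I)
  fix e :: real assume e: "e > 0"
  define \<delta> where "\<delta> = e / 2"
  have \<delta>: "\<delta> > 0" using e by (simp add: \<delta>_def)
  obtain c where c: "c > 0"
    and ev: "\<forall>\<^sub>F k in sequentially. d k \<ge> \<delta> \<longrightarrow> (d (Suc k))\<^sup>2 \<le> (d k)\<^sup>2 - c * mu k"
    using decr[OF \<delta>] by blast
  have "\<forall>\<^sub>F k in sequentially. s k < \<delta>" using order_tendstoD(2)[OF s \<delta>] .
  with ev step have "\<forall>\<^sub>F k in sequentially. d (Suc k) \<le> d k + \<delta> \<and>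
      (d k \<ge> \<delta> \<longrightarrow> (d (Suc k))\<^sup>2 \<le> (d k)\<^sup>2 - c * mu k)"
    by eventually_elim auto
  then obtain N where N1: "\<And>k. k \<ge> N \<Longrightarrow> d (Suc k) \<le> d k + \<delta>"
    and N2: "\<And>k. k \<ge> N \<Longrightarrow> d k \<ge> \<delta> \<Longrightarrow> (d (Suc k))\<^sup>2 \<le> (d k)\<^sup>2 - c * mu k"
    unfolding eventually_sequentially by blast
  have "\<exists>n\<ge>N. d n < \<delta>"
  proof (rule ccontr)
    assume "\<not> ?thesis"
    then have big: "d n \<ge> \<delta>" if "n \<ge> N" for n using that by force
    have tele: "c * (\<Sum>k<n. mu k) \<le> (d N)\<^sup>2 - (d n)\<^sup>2 + c * (\<Sum>k<N. mu k)" if "n \<ge> N" for n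
      using that
    proof (induction n rule: dec_induct)
      case base
      then show ?case by simp
    next
      case (step n)
      then show ?case using N2[of n] big[of n] by (simp add: algebra_simps)
    qed
    obtain n where n: "n \<ge> N" "(\<Sum>k<n. mu k) \<ge> ((d N)\<^sup>2 + 1) / c + (\<Sum>k<N. mu k)"
      using eventually_happens[OF eventually_conj[OF eventually_ge_at_top[of N]
          div[unfolded filterlim_at_top, rule_format, of "((d N)\<^sup>2 + 1) / c + (\<Sum>k<N. mu k)"]]]
      by auto
    have "c * (((d N)\<^sup>2 + 1) / c + (\<Sum>k<N. mu k)) \<le> c * (\<Sum>k<n. mu k)"
      using n(2) c by (intro mult_left_mono) auto
    moreover have "c * (((d N)\<^sup>2 + 1) / c + (\<Sum>k<N. mu k)) = (d N)\<^sup>2 + 1 + c * (\<Sum>k<N. mu k)"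
      using c by (simp add: distrib_left[of c "((d N)\<^sup>2 + 1) / c"])
    ultimately show False using tele[OF n(1)] zero_le_power2[of "d n"] by linarith
  qed
  then obtain n where n: "n \<ge> N" "d n < \<delta>" by blast
  have "d k < e" if "k \<ge> n" for k
    using that
  proof (induction k rule: dec_induct)
    case base
    then show ?case using n e by (simp add: \<delta>_def)
  next
    case (step k)
    show ?case
    proof (cases "d k < \<delta>")
      case True
      then show ?thesis using N1[of k] step n by (simp add: \<delta>_def)
    next
      case False
      then have "(d (Suc k))\<^sup>2 \<le> (d k)\<^sup>2 - c * mu k" using N2[of k] step n by simp
      also have "\<dots> \<le> (d k)\<^sup>2" using c mu[of k] by simp
      finally have "d (Suc k) \<le> d k" using d by (rule power2_le_imp_le)
      then show ?thesis using step by simp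
    qed
  qed
  then show "\<exists>no. \<forall>k\<ge>no. norm (d k - 0) < e" using d by (intro exI[of _ n]) simp
qed

section \<open>Convergence of the bilevel iterates\<close>

theorem theorem2:
  fixes m :: nat
    and F :: "nat \<Rightarrow> real ^ 'n \<Rightarrow> real"
    and f0 f1 :: "real ^ 'n \<Rightarrow> real"
    and X0 X1 X2 :: "(real ^ 'n) set"
    and C :: "nat \<Rightarrow> real" and D :: real
    and Op :: "real \<Rightarrow> real ^ 'n \<Rightarrow> real ^ 'n"
    and rho :: "real \<Rightarrow> nat \<Rightarrow> real"
    and lam mu :: "nat \<Rightarrow> real"
    and x y z :: "nat \<Rightarrow> real ^ 'n"
  assumes "m \<ge> 1"
    and "\<And>i. i \<in> {1..m} \<Longrightarrow> convex_on UNIV (F i)"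
    and "f0 = (\<lambda>u. \<Sum>i\<in>{1..m}. F i u)"
    and "convex_on UNIV f1"
    and "X0 \<noteq> {}" and "closed X0" and "convex X0"
    and "X1 = optimal_set f0 X0"
    and "X2 = optimal_set f1 X1"
    and "\<And>i u v. i \<in> {1..m} \<Longrightarrow> v \<in> subdifferential (F i) u \<Longrightarrow> norm v \<le> C i"
    and "\<And>u v. v \<in> subdifferential f1 u \<Longrightarrow> norm v \<le> D"
    and "\<And>k. lam k > 0" and "\<And>k. mu k > 0"
    and "lam \<longlonglongrightarrow> 0" and "mu \<longlonglongrightarrow> 0"
    and "filterlim (\<lambda>N. \<Sum>k<N. lam k) at_top sequentially"
    and "filterlim (\<lambda>N. \<Sum>k<N. mu k) at_top sequentially"
    and "(\<lambda>k. mu k / lam k) \<longlonglongrightarrow> 0"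
    and "(\<lambda>k. (lam k)\<^sup>2 / mu k) \<longlonglongrightarrow> 0"
    and "incremental_bilevel_iterates m F Op X0 lam mu x y z"
    and "bdd_below (range (\<lambda>k. f1 (y k)))"
    and "X2 \<noteq> {}"
    and "bounded X2 \<or> bounded (range x)"
    and "descent_property f1 Op rho"
    and "step_bound_property Op"
    and "(\<lambda>k. rho (mu k) k) \<longlonglongrightarrow> 0"
  shows "(\<lambda>k. proj_dist X2 (x k)) \<longlonglongrightarrow> 0"
proof -
  note cvxF = assms(2) and f0 = assms(3) and cvx1 = assms(4)
  note bdF = assms(10) and bd1 = assms(11) and lam_pos = assms(12) and mu_pos = assms(13)
  define S where "S = (\<Sum>i\<in>{1..m}. C i)"
  have S: "S \<ge> 0"
    unfolding S_def by (intro sum_nonneg subdifferential_bound_nonneg[OF cvxF bdF])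
  have D: "D \<ge> 0" by (rule subdifferential_bound_nonneg[OF cvx1 bd1])
  have lip1: "f1 u - f1 w \<le> D * norm (u - w)" for u w
    by (rule convex_bounded_subdifferential_lipschitz[OF cvx1 bd1])
  have cvx0: "convex_on UNIV f0"
    unfolding f0 using cvxF by (intro convex_on_finite_sum) auto

  obtain us where us: "us \<in> X2" using assms(22) by blast
  have us1: "us \<in> X1" and us2: "us \<in> optimal_set f1 X1"
    using us optimal_set_sublevel(2) assms(9) by auto
  then have us0: "us \<in> X0" and us01: "us \<in> optimal_set f0 X0"
    using optimal_set_sublevel(2) assms(8) by auto
  define a where "a u = f0 u - f0 us" for u
  define b where "b u = f1 u - f1 us" for u
  define g where "g u = max (a u) (b u)" for u
  have a_nonneg: "a u \<ge> 0" if "u \<in> X0" for u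
    using optimal_set_sublevel(3)[OF us01 that] by (simp add: a_def)
  have X2: "X2 = {u \<in> X0. g u \<le> 0}"
    using optimal_set_sublevel(1)[OF us01] optimal_set_sublevel(1)[OF us2]
    unfolding g_def a_def b_def assms(8,9) by auto
  have cvxg: "convex_on UNIV g"
  proof -
    have "a (u *\<^sub>R p + v *\<^sub>R q) \<le> u * a p + v * a q" "b (u *\<^sub>R p + v *\<^sub>R q) \<le> u * b p + v * b q"
      if "u \<ge> 0" "v \<ge> 0" "u + v = 1" for u v :: real and p q
    proof -
      have "f0 us = u * f0 us + v * f0 us" "f1 us = u * f1 us + v * f1 us"
        using that(3) by (metis distrib_right mult_1)+
      moreover have "f0 (u *\<^sub>R p + v *\<^sub>R q) \<le> u * f0 p + v * f0 q"
        "f1 (u *\<^sub>R p + v *\<^sub>R q) \<le> u * f1 p + v * f1 q"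
        using cvx0 cvx1 that unfolding convex_on_def by auto
      ultimately show "a (u *\<^sub>R p + v *\<^sub>R q) \<le> u * a p + v * a q"
        "b (u *\<^sub>R p + v *\<^sub>R q) \<le> u * b p + v * b q"
        unfolding a_def b_def by (auto simp: right_diff_distrib)
    qed
    moreover have "u * a p + v * a q \<le> u * g p + v * g q" "u * b p + v * b q \<le> u * g p + v * g q"
      if "u \<ge> 0" "v \<ge> 0" for u v :: real and p q
      using that unfolding g_def by (auto intro!: add_mono mult_left_mono)
    ultimately have "a (u *\<^sub>R p + v *\<^sub>R q) \<le> u * g p + v * g q \<and>
        b (u *\<^sub>R p + v *\<^sub>R q) \<le> u * g p + v * g q"
      if "u \<ge> 0" "v \<ge> 0" "u + v = 1" for u v :: real and p q
      using that order_trans by meson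
    then have "g (u *\<^sub>R p + v *\<^sub>R q) \<le> u * g p + v * g q"
      if "u \<ge> 0" "v \<ge> 0" "u + v = 1" for u v :: real and p q
      using that unfolding g_def[of "u *\<^sub>R p + v *\<^sub>R q"] by simp
    then show ?thesis
      unfolding convex_on_def by simp
  qed
  have contg: "continuous_on UNIV g"
    using cvxg by (intro convex_on_continuous) auto
  have "closed {u. g u \<le> 0}"
    using contg by (intro closed_Collect_le continuous_intros) auto
  moreover have "X2 = X0 \<inter> {u. g u \<le> 0}" by (auto simp: X2)
  ultimately have clX2: "closed X2" using assms(6) by (simp add: closed_Int)
  have pd: "proj_dist X2 u = infdist u X2" for u
    by (rule proj_dist_eq_infdist[OF clX2 assms(22)])

  have yk: "y k \<in> incremental_subgradient m F (lam k) (x k)" and zk: "z k = Op (mu k) (y k)"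
    and xk: "x (Suc k) = closest_point X0 (z k)" for k
    using assms(20) unfolding incremental_bilevel_iterates_def by auto
  \<comment> \<open>The starting point may lie outside \<open>X0\<close>, where \<open>a\<close> can be negative.\<close>
  have x_in: "x k \<in> X0" if "k \<ge> 1" for k
    using that xk closest_point_in_set[OF assms(6,5)] by (cases k) auto

  have gap: "\<exists>c>0. \<forall>k\<ge>1. infdist (x k) X2 \<ge> \<delta> \<longrightarrow> g (x k) \<ge> c" if \<delta>: "\<delta> > 0" for \<delta>
    using assms(23)
  proof
    assume "bounded X2"
    then show ?thesis
      using positive_gap_of_bounded_sublevel[OF assms(6,7) cvxg \<delta>] assms(22) x_in
      unfolding X2[symmetric] by blast
  next
    assume "bounded (range x)"
    then show ?thesis
      using positive_gap_on_bounded[OF assms(6) contg _ \<delta>, of "range x"] x_in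
      unfolding X2[symmetric] by blast
  qed

  obtain \<beta> where \<beta>: "\<beta> > 0" and desc: "\<And>t k u v. t \<ge> 0 \<Longrightarrow>
      (norm (Op t u - v))\<^sup>2 \<le> (norm (u - v))\<^sup>2 - \<beta> * t * (f1 (Op t u) - f1 v) + t * rho t k"
    using assms(24) unfolding descent_property_def by blast
  obtain \<gamma> where \<gamma>: "\<gamma> > 0" and opstep: "\<And>t u. t \<ge> 0 \<Longrightarrow> norm (u - Op t u) \<le> t * \<gamma>"
    using assms(25) unfolding step_bound_property_def by blast
  have yx: "norm (y k - x k) \<le> lam k * S" for k
    unfolding S_def using incremental_subgradient_pass(1)[OF cvxF bdF _ yk] lam_pos[of k] by simp
  define s where "s k = lam k * S + mu k * \<gamma>" for k
  have zx: "norm (z k - x k) \<le> s k" for k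
  proof -
    have "norm (z k - x k) \<le> norm (z k - y k) + norm (y k - x k)"
      using norm_triangle_ineq[of "z k - y k" "y k - x k"] by simp
    moreover have "norm (z k - y k) \<le> mu k * \<gamma>"
      using opstep[of "mu k" "y k"] mu_pos[of k] zk[of k] by (simp add: norm_minus_commute)
    ultimately show ?thesis using yx[of k] by (simp add: s_def)
  qed
  have "s \<longlonglongrightarrow> 0 * S + 0 * \<gamma>"
    unfolding s_def by (intro tendsto_intros assms(14,15))
  then have s0: "s \<longlonglongrightarrow> 0" by simp

  define d where "d k = infdist (x k) X2" for k
  have near: "d (Suc k) \<le> d k + s k" if "k \<ge> 1" for k
  proof -
    have "dist (x (Suc k)) (x k) \<le> dist (z k) (x k)"
      using closest_point_lipschitz[OF assms(7,6,5), of "z k" "x k"] closest_point_self[OF x_in[OF that]]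
      by (simp add: xk)
    then have "dist (x (Suc k)) (x k) \<le> s k" using zx[of k] by (simp add: dist_norm)
    then show ?thesis using infdist_triangle[of "x (Suc k)" X2 "x k"] by (simp add: d_def)
  qed

  \<comment> \<open>The error term multiplying \<open>mu k\<close>; its first summand is the pass error \<open>(lam k * S)\<^sup>2\<close>.\<close>
  define e where "e k = (lam k)\<^sup>2 / mu k * S\<^sup>2 + \<beta> * D * s k + rho (mu k) k" for k
  have "e \<longlonglongrightarrow> 0 * S\<^sup>2 + \<beta> * D * 0 + 0"
    unfolding e_def by (intro tendsto_intros assms(19,26) s0)
  then have e0: "e \<longlonglongrightarrow> 0" by simp

  \<comment> \<open>Compare with the point \<open>u\<close> of \<open>X2\<close> closest to \<open>x k\<close>: it bounds \<open>d (Suc k)\<close> from above and realizes \<open>d k\<close>.\<close>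
  have main: "(d (Suc k))\<^sup>2 \<le> (d k)\<^sup>2 - 2 * lam k * a (x k) - mu k * (\<beta> * b (x k)) + mu k * e k" for k
  proof -
    define u where "u = closest_point X2 (x k)"
    have u: "u \<in> X2" unfolding u_def by (rule closest_point_in_set[OF clX2 assms(22)])
    then have "u \<in> X0" "a u \<le> 0" "b u \<le> 0" by (auto simp: X2 g_def)
    have dk: "norm (x k - u) = d k" using pd[of "x k"] by (simp add: d_def u_def proj_dist_def)
    have "f0 u \<le> f0 us" "f1 u \<le> f1 us" using \<open>a u \<le> 0\<close> \<open>b u \<le> 0\<close> by (auto simp: a_def b_def)
    have "d (Suc k) \<le> norm (x (Suc k) - u)"
      using infdist_le[OF u, of "x (Suc k)"] by (simp add: d_def dist_norm)
    also have "\<dots> \<le> norm (z k - u)"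
      using closest_point_lipschitz[OF assms(7,6,5), of "z k" u] closest_point_self[OF \<open>u \<in> X0\<close>]
      by (simp add: xk dist_norm)
    finally have "(d (Suc k))\<^sup>2 \<le> (norm (z k - u))\<^sup>2"
      by (intro power_mono) (auto simp: d_def infdist_nonneg)
    also have "\<dots> \<le> (norm (y k - u))\<^sup>2 - \<beta> * mu k * (f1 (z k) - f1 u) + mu k * rho (mu k) k"
      using desc[of "mu k" "y k" u k] mu_pos[of k] by (simp add: zk)
    also have "\<dots> \<le> (norm (y k - u))\<^sup>2 - \<beta> * mu k * (b (x k) - D * s k) + mu k * rho (mu k) k"
    proof -
      \<comment> \<open>The descent inequality evaluates \<open>f1\<close> at \<open>z k\<close>, whereas the gap is known at \<open>x k\<close>.\<close>
      have "D * norm (x k - z k) \<le> D * s k"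
        using zx[of k] D by (intro mult_left_mono) (auto simp: norm_minus_commute)
      then have "f1 (x k) - f1 (z k) \<le> D * s k" using lip1[of "x k" "z k"] by linarith
      then have "b (x k) - D * s k \<le> f1 (z k) - f1 u"
        using \<open>f1 u \<le> f1 us\<close> by (simp add: b_def)
      then have "\<beta> * mu k * (b (x k) - D * s k) \<le> \<beta> * mu k * (f1 (z k) - f1 u)"
        using \<beta> mu_pos[of k] by (intro mult_left_mono) auto
      then show ?thesis by simp
    qed
    also have "(norm (y k - u))\<^sup>2 \<le> (d k)\<^sup>2 - 2 * lam k * a (x k) + (lam k)\<^sup>2 * S\<^sup>2"
    proof -
      have "(norm (y k - u))\<^sup>2 \<le> (d k)\<^sup>2 - 2 * lam k * (f0 (x k) - f0 u) + (lam k)\<^sup>2 * S\<^sup>2"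
        using incremental_subgradient_pass(2)[OF cvxF bdF _ yk[of k], where u = u] lam_pos[of k]
        by (simp add: S_def f0 dk)
      moreover have "2 * lam k * a (x k) \<le> 2 * lam k * (f0 (x k) - f0 u)"
        using \<open>f0 u \<le> f0 us\<close> lam_pos[of k] by (intro mult_left_mono) (auto simp: a_def)
      ultimately show ?thesis by linarith
    qed
    also have "(lam k)\<^sup>2 * S\<^sup>2 = mu k * ((lam k)\<^sup>2 / mu k * S\<^sup>2)"
      using mu_pos[of k] by simp
    finally show ?thesis by (simp add: e_def algebra_simps)
  qed

  obtain L where L: "\<And>k. f1 (y k) \<ge> L"
    using assms(21) unfolding bdd_below_def by auto
  \<comment> \<open>The summand \<open>1\<close> absorbs the change of \<open>f1\<close> from \<open>y k\<close>, where the bound is given, to \<open>x k\<close>.\<close>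
  define M where "M = \<bar>f1 us - L + 1\<bar>"
  have b_lower: "\<forall>\<^sub>F k in sequentially. b (x k) \<ge> - M"
  proof -
    have "(\<lambda>k. D * (lam k * S)) \<longlonglongrightarrow> D * (0 * S)"
      by (intro tendsto_intros assms(14))
    then have "\<forall>\<^sub>F k in sequentially. D * (lam k * S) < 1"
      using order_tendstoD(2)[of _ "D * (0 * S)" sequentially 1] by simp
    then show ?thesis
    proof eventually_elim
      case (elim k)
      have "D * norm (y k - x k) \<le> D * (lam k * S)" using yx[of k] D by (rule mult_left_mono)
      then have "f1 (x k) \<ge> L - 1" using lip1[of "y k" "x k"] L[of k] elim by linarith
      then show ?case by (simp add: b_def M_def)
    qed
  qed

  have "d \<longlonglongrightarrow> 0"
  proof (rule tendsto_zero_of_decrease_away_from_zero[of d s mu])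
    show "d k \<ge> 0" for k by (simp add: d_def infdist_nonneg)
    show "\<forall>\<^sub>F k in sequentially. d (Suc k) \<le> d k + s k"
      using near unfolding eventually_sequentially by blast
    show "s \<longlonglongrightarrow> 0" by fact
    show "mu k \<ge> 0" for k using mu_pos[of k] by simp
    show "filterlim (\<lambda>N. \<Sum>k<N. mu k) at_top sequentially" by fact
    fix \<delta> :: real assume "\<delta> > 0"
    then obtain c where c: "c > 0" and gc: "\<And>k. k \<ge> 1 \<Longrightarrow> d k \<ge> \<delta> \<Longrightarrow> g (x k) \<ge> c"
      using gap unfolding d_def by blast
    have M: "\<beta> * (M + c) > 0" using \<beta> c by (simp add: M_def)
    have ev_e: "\<forall>\<^sub>F k in sequentially. e k < \<beta> * c / 2"
      by (rule order_tendstoD(2)[OF e0]) (use \<beta> c in simp)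
    \<comment> \<open>The threshold at which a gap \<open>c\<close> in \<open>f0\<close>, weighted by \<open>2 * lam k\<close>, outweighs \<open>b \<ge> - M\<close>.\<close>
    have ev_r: "\<forall>\<^sub>F k in sequentially. mu k / lam k < 2 * c / (\<beta> * (M + c))"
      by (rule order_tendstoD(2)[OF assms(18)]) (use c M in simp)
    \<comment> \<open>Half of the drop \<open>\<beta> * c * mu k\<close> is spent on the error \<open>mu k * e k\<close>.\<close>
    have "\<forall>\<^sub>F k in sequentially. d k \<ge> \<delta> \<longrightarrow> (d (Suc k))\<^sup>2 \<le> (d k)\<^sup>2 - \<beta> * c / 2 * mu k"
      using ev_e ev_r b_lower eventually_ge_at_top[of 1]
    proof eventually_elim
      case (elim k)
      show ?case
      proof
        assume "d k \<ge> \<delta>"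
        then have "a (x k) \<ge> c \<or> b (x k) \<ge> c" using gc[of k] elim(4) by (simp add: g_def le_max_iff_disj)
        then have drop: "mu k * (\<beta> * c) \<le> 2 * lam k * a (x k) + mu k * (\<beta> * b (x k))"
        proof
          assume bc: "b (x k) \<ge> c"
          have "0 \<le> 2 * lam k * a (x k)"
            using a_nonneg[OF x_in] elim lam_pos[of k] by simp
          moreover have "mu k * (\<beta> * c) \<le> mu k * (\<beta> * b (x k))"
            using bc \<beta> mu_pos[of k] by (intro mult_left_mono) auto
          ultimately show ?thesis by linarith
        next
          assume ac: "a (x k) \<ge> c"
          have "mu k * (\<beta> * (M + c)) \<le> 2 * c * lam k"
            using elim(2) M lam_pos[of k] by (simp add: field_simps)
          also have "\<dots> \<le> 2 * lam k * a (x k)"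
            using ac lam_pos[of k] by simp
          finally have "mu k * (\<beta> * (M + c)) \<le> 2 * lam k * a (x k)" .
          moreover have "mu k * (\<beta> * (- M)) \<le> mu k * (\<beta> * b (x k))"
            using elim(3) \<beta> mu_pos[of k] by (intro mult_left_mono) auto
          ultimately show ?thesis by (simp add: algebra_simps)
        qed
        have "mu k * e k \<le> mu k * (\<beta> * c / 2)"
          using elim(1) mu_pos[of k] by (intro mult_left_mono) auto
        moreover have "mu k * (\<beta> * c / 2) = mu k * (\<beta> * c) - \<beta> * c / 2 * mu k" by simp
        ultimately show "(d (Suc k))\<^sup>2 \<le> (d k)\<^sup>2 - \<beta> * c / 2 * mu k"
          using main[of k] drop by linarith
      qed
    qed
    then show "\<exists>c>0. \<forall>\<^sub>F k in sequentially. d k \<ge> \<delta> \<longrightarrow> (d (Suc k))\<^sup>2 \<le> (d k)\<^sup>2 - c * mu k"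
      using \<beta> c by (intro exI[of _ "\<beta> * c / 2"]) simp
  qed
  then show ?thesis by (simp add: d_def[abs_def] pd)
qed

end
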